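(* Let $\alpha\ge 1$ be a real number. For each $n\ge 1$ let $Q_n=\{q_1,\dots,q_n\}$ be independent random points uniformly distributed on $[0,1]$, let $q^{(1)}\le\dots\le q^{(n)}$ be their order statistics, set $q^{(0)}=0$ and $q^{(n+1)}=1$, and let $$D^{d=1}_{Q_n,\alpha}=\sum_{i=0}^{n}\bigl|q^{(i+1)}-q^{(i)}\bigr|^\alpha .$$ Then $$\lim_{n\to\infty}\mathbb E\bigl[n^{\alpha-1}D^{d=1}_{Q_n,\alpha}\bigr]=\Gamma(\alpha+1)$$ and $$\lim_{n\to\infty} n\,\mathrm{Var}\bigl[n^{\alpha-1}D^{d=1}_{Q_n,\alpha}\bigr]=\Gamma(2\alpha+1)-(\alpha^2+1)\,\Gamma(\alpha+1)^2 .$$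
   Context: $\Gamma$ denotes the Euler Gamma function. The quantity $D^{d=1}_{Q_n,\alpha}$ is the sample Fermat distance between $0$ and $1$ in dimension one. *)

theory Defs
  imports "HOL-Probability.Probability"
begin

text \<open>
  The points are \<open>x 1, \<dots>, x n\<close>; values of \<open>x\<close> at other indices are ignored.
  The order statistics are counted with multiplicity and are extended by the end points:
  index \<open>0\<close> gives \<open>0\<close> and index \<open>n + 1\<close> gives \<open>1\<close>.
  Indices above \<open>n + 1\<close> are meaningless.
\<close>

definition ext_order_stat :: "nat \<Rightarrow> (nat \<Rightarrow> real) \<Rightarrow> nat \<Rightarrow> real" where
  "ext_order_stat n x k =
     (if k = 0 then 0
      else if k = n + 1 then 1
      else sort (map x [1..<n + 1]) ! (k - 1))"

text \<open>Coinciding points contribute \<open>0 powr \<alpha> = 0\<close>, as they should for \<open>\<alpha> \<ge> 1\<close>.\<close>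

definition sample_fermat_dist_1d :: "real \<Rightarrow> nat \<Rightarrow> (nat \<Rightarrow> real) \<Rightarrow> real" where
  "sample_fermat_dist_1d \<alpha> n x =
     (\<Sum>i=0..n. \<bar>ext_order_stat n x (i + 1) - ext_order_stat n x i\<bar> powr \<alpha>)"

end

theory Submission
  imports Defs "HOL-Real_Asymp.Real_Asymp"
begin

text \<open>
  For \<open>n\<close> uniform points on \<open>[0, L]\<close>, condition on the largest point \<open>m\<close>: the remaining points are
  uniform on \<open>[0, m]\<close>, and the last gap contributes \<open>(L - m) powr \<alpha>\<close>. By scaling, the first two
  moments are a constant times a power of \<open>L\<close>, so this recursion reduces to Beta integrals and yields
  \<open>E D = (n+1) n! \<Gamma>(\<alpha>+1) / \<Gamma>(n+\<alpha>+1)\<close> and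
  \<open>E D\<^sup>2 = (n+1) n! (\<Gamma>(2\<alpha>+1) + n \<Gamma>(\<alpha>+1)\<^sup>2) / \<Gamma>(n+2\<alpha>+1)\<close>.
  The leading terms cancel in the variance, so its limit needs the quotient
  \<open>\<Gamma>(n+\<alpha>+1)\<^sup>2 / (n! \<Gamma>(n+2\<alpha>+1))\<close> to second order, namely \<open>1 - \<alpha>\<^sup>2/n + o(1/n)\<close>.
\<close>

section \<open>Gap sums and order statistics\<close>

text \<open>The right end \<open>L\<close> is a parameter because, once the largest point
  \<open>m\<close> is split off, the remaining points form a sample on the interval from 0 to
  \<open>m\<close>.\<close>

definition gap_power_sum :: "real \<Rightarrow> real \<Rightarrow> real list \<Rightarrow> real" where
  "gap_power_sum \<alpha> L ys = (\<Sum>k\<le>length ys. \<bar>(0 # ys @ [L]) ! Suc k - (0 # ys @ [L]) ! k\<bar> powr \<alpha>)"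

text \<open>The index set is arbitrary because deleting the index of the largest point from {1..n}
  generally leaves a set with a hole. Going through multisets keeps repeated values.\<close>

definition ordered :: "('i \<Rightarrow> 'a::linorder) \<Rightarrow> 'i set \<Rightarrow> 'a list" where
  "ordered x I = sorted_list_of_multiset (image_mset x (mset_set I))"

lemma gap_power_sum_nonneg: "gap_power_sum \<alpha> L ys \<ge> 0"
  by (simp add: gap_power_sum_def sum_nonneg)

lemma gap_power_sum_Nil: "gap_power_sum \<alpha> L [] = \<bar>L\<bar> powr \<alpha>"
  by (simp add: gap_power_sum_def)

text \<open>Only the last segment, from \<open>m\<close> to \<open>L\<close>, sees \<open>L\<close>;
  all other segments are those of \<open>zs\<close> with right end \<open>m\<close>. This is the
  pointwise form of the recursion, and it needs no sortedness.\<close>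

lemma gap_power_sum_snoc:
  "gap_power_sum \<alpha> L (zs @ [m]) = gap_power_sum \<alpha> m zs + \<bar>L - m\<bar> powr \<alpha>"
proof -
  have "(0 # (zs @ [m]) @ [L]) ! k = (0 # zs @ [m]) ! k" if "k \<le> Suc (length zs)" for k
    using that nth_append[of "0 # zs @ [m]" "[L]" k] by simp
  then have "(\<Sum>k\<le>length zs. \<bar>(0 # (zs @ [m]) @ [L]) ! Suc k - (0 # (zs @ [m]) @ [L]) ! k\<bar> powr \<alpha>)
      = gap_power_sum \<alpha> m zs"
    unfolding gap_power_sum_def by (intro sum.cong refl) (simp only: atMost_iff le_SucI Suc_le_mono)
  then show ?thesis
    by (simp add: gap_power_sum_def[of \<alpha> L] nth_append)
qed

lemma length_ordered [simp]: "length (ordered x I) = card I"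
  by (metis mset_sorted_list_of_multiset ordered_def size_image_mset size_mset size_mset_set)

lemma ordered_sorted: "sorted (ordered x I)"
  by (simp add: ordered_def)

lemma ordered_empty [simp]: "ordered x {} = []"
  by (simp add: ordered_def)

lemma ordered_cong: "(\<And>i. i \<in> I \<Longrightarrow> x i = y i) \<Longrightarrow> ordered x I = ordered y I"
  unfolding ordered_def by (cases "finite I") (auto intro!: arg_cong[of _ _ sorted_list_of_multiset] image_mset_cong)

text \<open>Appending a largest value to the sorted list of the others gives a sorted list with the
  right multiset, and such a list is unique. Ties with the value at \<open>j\<close> do no
  harm.\<close>

lemma ordered_remove_max:
  assumes "finite I" "j \<in> I" "\<And>i. i \<in> I - {j} \<Longrightarrow> x i \<le> x j"
  shows "ordered x I = ordered x (I - {j}) @ [x j]"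
proof -
  have "mset (ordered x (I - {j}) @ [x j]) = mset (ordered x I)"
    using mset_set.remove[OF assms(1,2)] by (simp add: ordered_def)
  moreover have "sorted (ordered x (I - {j}) @ [x j])"
    using assms by (auto simp: ordered_def sorted_append)
  ultimately have "sort (ordered x I) = ordered x (I - {j}) @ [x j]"
    by (rule properties_for_sort)
  then show ?thesis by (simp add: ordered_def)
qed

section \<open>Measurability of order statistics and gap sums\<close>

lemma sorted_nth_le_iff:
  assumes "sorted ys" "k < length ys"
  shows "ys ! k \<le> c \<longleftrightarrow> k < length (filter (\<lambda>y. y \<le> c) ys)"
  using assms
proof (induction ys arbitrary: k)
  case (Cons y ys)
  show ?case
  proof (cases "y \<le> c")
    case True
    then show ?thesis using Cons by (cases k) auto
  next
    case False
    then have "\<not> z \<le> c" if "z \<in> set (y # ys)" for z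
      using Cons.prems(1) that by auto
    then have "filter (\<lambda>y. y \<le> c) ys = []" "\<not> (y # ys) ! k \<le> c"
      using nth_mem[OF Cons.prems(2)] by (simp_all add: filter_empty_conv del: nth_mem)
    with False show ?thesis by simp
  qed
qed simp

text \<open>In a sorted list the entries up to \<open>c\<close> form an initial segment, so its
  length decides. The condition on an order statistic becomes a count over the unsorted coordinates,
  which is visibly measurable.\<close>

lemma ordered_nth_le_iff:
  assumes "finite I" "k < card I"
  shows "ordered x I ! k \<le> c \<longleftrightarrow> k < card {i \<in> I. x i \<le> c}"
proof -
  have "length (filter (\<lambda>y. y \<le> c) (ordered x I)) = size (mset (filter (\<lambda>y. y \<le> c) (ordered x I)))"
    by (rule size_mset[symmetric])
  also have "\<dots> = card {i \<in> I. x i \<le> c}"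
    using assms(1) by (simp add: ordered_def filter_mset_image_mset del: size_mset)
  finally show ?thesis
    using sorted_nth_le_iff[of "ordered x I" k c] assms(2) by (simp add: ordered_sorted)
qed

lemma measurable_ordered_nth:
  assumes "finite I" "k < card I"
  shows "(\<lambda>x. ordered x I ! k :: real) \<in> borel_measurable (\<Pi>\<^sub>M i\<in>I. lborel)"
proof (rule borel_measurable_iff_le[THEN iffD2], intro allI)
  fix c :: real
  have "(\<lambda>x. \<Sum>i\<in>I. if x i \<le> c then 1 else 0 :: nat) \<in> measurable (\<Pi>\<^sub>M i\<in>I. lborel) (count_space UNIV)"
    by measurable
  also have "(\<lambda>x. \<Sum>i\<in>I. if x i \<le> c then 1 else 0 :: nat) = (\<lambda>x. card {i \<in> I. x i \<le> c})"
    using assms(1) by (simp add: sum.If_cases Int_def fun_eq_iff)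
  finally have [measurable]: "(\<lambda>x. card {i \<in> I. x i \<le> c}) \<in> measurable (\<Pi>\<^sub>M i\<in>I. lborel) (count_space UNIV)" .
  have "{x \<in> space (\<Pi>\<^sub>M i\<in>I. lborel). k < card {i \<in> I. x i \<le> c}} \<in> sets (\<Pi>\<^sub>M i\<in>I. lborel)"
    by measurable
  then show "{x \<in> space (\<Pi>\<^sub>M i\<in>I. lborel). ordered x I ! k \<le> c} \<in> sets (\<Pi>\<^sub>M i\<in>I. lborel)"
    by (simp add: ordered_nth_le_iff[OF assms])
qed

lemma measurable_gap_power_sum [measurable]:
  assumes "finite I"
  shows "(\<lambda>x. gap_power_sum \<alpha> L (ordered x I)) \<in> borel_measurable (\<Pi>\<^sub>M i\<in>I. lborel)"
proof -
  have M: "(\<lambda>x. (0 # ordered x I @ [L]) ! k) \<in> borel_measurable (\<Pi>\<^sub>M i\<in>I. lborel)"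
    if "k \<le> Suc (card I)" for k
  proof (cases "k \<in> {0, Suc (card I)}")
    case True
    then show ?thesis by (auto simp: nth_append)
  next
    case False
    then obtain l where "k = Suc l" "l < card I"
      using \<open>k \<le> Suc (card I)\<close> by (cases k) auto
    then show ?thesis
      using measurable_ordered_nth[OF assms] by (simp add: nth_append)
  qed
  show ?thesis
    unfolding gap_power_sum_def length_ordered
    by (intro borel_measurable_sum measurable_abs_powr borel_measurable_diff M)
       (simp_all only: atMost_iff le_SucI Suc_le_mono)
qed

lemma sample_fermat_dist_1d_eq:
  "sample_fermat_dist_1d \<alpha> n x = gap_power_sum \<alpha> 1 (ordered x {1..n})"
proof -
  have "sort (map x [1..<n + 1]) = ordered x {1..n}"
    unfolding ordered_def
    by (metis Suc_eq_plus1 atLeastLessThanSuc_atLeastAtMost mset_map mset_upt sorted_list_of_multiset_mset)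
  \<comment> \<open>The two conventions for the end points agree up to index n + 1, and the sum uses
    no larger index.\<close>
  then have "ext_order_stat n x k = (0 # ordered x {1..n} @ [1]) ! k" if "k \<le> Suc n" for k
    using that by (cases k) (auto simp: ext_order_stat_def nth_append)
  then show ?thesis
    by (simp add: sample_fermat_dist_1d_def gap_power_sum_def atLeast0AtMost)
qed

section \<open>Conditioning on the largest point\<close>

interpretation lborel_product: product_sigma_finite "\<lambda>_. lborel :: real measure"
  by standard

text \<open>By Fubini with coordinate \<open>i\<close> innermost, the set where coordinates
  \<open>i\<close> and \<open>j\<close> coincide has sections consisting of one point, hence is
  null. There are only finitely many pairs.\<close>

lemma AE_PiM_lborel_inj_on:
  assumes "finite I"
  shows "AE x in (\<Pi>\<^sub>M i\<in>I. lborel :: real measure). inj_on x I"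
proof -
  have "AE x in (\<Pi>\<^sub>M i\<in>I. lborel :: real measure). x i \<noteq> x j" if ij: "i \<in> I" "j \<in> I" "i \<noteq> j" for i j
  proof -
    let ?P = "\<Pi>\<^sub>M i\<in>I. lborel :: real measure"
    have I: "insert i (I - {i}) = I" and J: "finite (I - {i})" "i \<notin> I - {i}" using ij assms by auto
    have [measurable]: "(\<lambda>x. x i) \<in> borel_measurable ?P" "(\<lambda>x. x j) \<in> borel_measurable ?P"
      using ij by simp_all
    have S: "{x \<in> space ?P. x i = x j} \<in> sets ?P" by measurable
    have "emeasure ?P {x \<in> space ?P. x i = x j} = (\<integral>\<^sup>+ x. (if x i = x j then 1 else 0) \<partial>?P)"
      unfolding nn_integral_indicator[OF S, symmetric] by (intro nn_integral_cong) (auto simp: indicator_def)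
    also have "\<dots> = (\<integral>\<^sup>+ x. (\<integral>\<^sup>+ y. (if (x(i := y)) i = (x(i := y)) j then 1 else 0) \<partial>lborel)
        \<partial>(\<Pi>\<^sub>M i\<in>I - {i}. lborel :: real measure))"
      by (rule lborel_product.product_nn_integral_insert[OF J, of "\<lambda>x. if x i = x j then 1 else 0", unfolded I]) measurable
    also have "\<dots> = (\<integral>\<^sup>+ x. (\<integral>\<^sup>+ y. indicator {x j} y \<partial>lborel) \<partial>(\<Pi>\<^sub>M i\<in>I - {i}. lborel :: real measure))"
      using ij by (intro nn_integral_cong) (auto simp: indicator_def)
    also have "\<dots> = 0" by simp
    finally show ?thesis using S by (intro AE_I'[of "{x \<in> space ?P. x i = x j}"]) auto
  qed
  then have "AE x in (\<Pi>\<^sub>M i\<in>I. lborel :: real measure). \<forall>i\<in>I. \<forall>j\<in>I. i \<noteq> j \<longrightarrow> x i \<noteq> x j"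
    using assms by (intro AE_finite_allI) auto
  then show ?thesis by eventually_elim (auto simp: inj_on_def)
qed

text \<open>
  Almost every point of the cube has a unique largest coordinate \<open>j\<close>. The cube excludes \<open>0\<close> because
  its volume will be written \<open>m powr n\<close>, and \<open>0 powr 0 = 0\<close>.
\<close>
lemma nn_integral_cube_split_max:
  fixes h :: "real \<Rightarrow> ennreal"
  assumes I: "finite I" "I \<noteq> {}" and [measurable]: "h \<in> borel_measurable borel"
  shows "(\<integral>\<^sup>+ x. (\<Prod>i\<in>I. indicator {0<..L} (x i)) * h (gap_power_sum \<alpha> L (ordered x I)) \<partial>(\<Pi>\<^sub>M i\<in>I. lborel))
    = (\<Sum>j\<in>I. \<integral>\<^sup>+ m. indicator {0<..L} m *
        (\<integral>\<^sup>+ x. (\<Prod>i\<in>I - {j}. indicator {0<..m} (x i)) *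
           h (gap_power_sum \<alpha> m (ordered x (I - {j})) + \<bar>L - m\<bar> powr \<alpha>) \<partial>(\<Pi>\<^sub>M i\<in>I - {j}. lborel)) \<partial>lborel)"
proof -
  let ?P = "\<lambda>I. \<Pi>\<^sub>M i\<in>I. lborel :: real measure"
  \<comment> \<open>\<open>F j\<close> is the integrand restricted to the region where coordinate
    \<open>j\<close> is largest. The bound \<open>L\<close> is imposed on that coordinate only; the
    others are bounded by it.\<close>
  define F where "F j x = (indicator {0<..L} (x j) * (\<Prod>i\<in>I - {j}. indicator {0<..x j} (x i))) *
    h (gap_power_sum \<alpha> L (ordered x I))" for j x
  have F_measurable [measurable]: "F j \<in> borel_measurable (?P I)" if j: "j \<in> I" for j
  proof -
    have [measurable]: "(\<lambda>x. indicator {0<..x j} (x i) :: ennreal) \<in> borel_measurable (?P I)" if i: "i \<in> I" for i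
    proof -
      have "{x \<in> space (?P I). 0 < x i \<and> x i \<le> x j} \<in> sets (?P I)"
        using i j by (intro sets.sets_Collect_conj borel_measurable_less borel_measurable_le) simp_all
      then show ?thesis
        by (subst measurable_cong[of _ _ "indicator {x \<in> space (?P I). 0 < x i \<and> x i \<le> x j}"])
           (auto simp: indicator_def)
    qed
    show ?thesis
      unfolding F_def using j I(1) by measurable
  qed
  \<comment> \<open>Without ties exactly one summand survives: for every other index
    \<open>k\<close>, the factor belonging to the true maximum vanishes. In the surviving summand,
    bounding the other coordinates by the maximum is equivalent to bounding them by
    \<open>L\<close>.\<close>
  have "AE x in ?P I. (\<Prod>i\<in>I. indicator {0<..L} (x i)) * h (gap_power_sum \<alpha> L (ordered x I)) = (\<Sum>j\<in>I. F j x)"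
    using AE_PiM_lborel_inj_on[OF I(1)]
  proof eventually_elim
    case (elim x)
    obtain j where j: "j \<in> I" "x j = Max (x ` I)"
      using Max_in[of "x ` I"] I by fastforce
    then have le: "x i \<le> x j" if "i \<in> I" for i using that I by simp
    have zero: "F k x = 0" if "k \<in> I - {j}" for k
    proof -
      have "x k < x j" using that le[of k] elim j by (auto simp: inj_on_def order.strict_iff_order)
      then have "(\<Prod>i\<in>I - {k}. indicator {0<..x k} (x i) :: ennreal) = 0"
        using that j I(1) by (intro prod_zero bexI[of _ j]) auto
      then show ?thesis by (simp add: F_def)
    qed
    have "(\<Sum>k\<in>I. F k x) = F j x"
      using sum.remove[OF I(1) j(1), of "\<lambda>k. F k x"] zero by simp
    moreover have "(\<Prod>i\<in>I. indicator {0<..L} (x i) :: ennreal)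
        = indicator {0<..L} (x j) * (\<Prod>i\<in>I - {j}. indicator {0<..x j} (x i))"
    proof (cases "x j \<in> {0<..L}")
      case True
      then have "(\<Prod>i\<in>I - {j}. indicator {0<..L} (x i) :: ennreal) = (\<Prod>i\<in>I - {j}. indicator {0<..x j} (x i))"
        using le by (intro prod.cong) (fastforce simp: indicator_def)+
      then show ?thesis using prod.remove[OF I(1) j(1)] by metis
    next
      case False
      then show ?thesis by (subst prod.remove[OF I(1) j(1)]) simp
    qed
    ultimately show ?case by (simp add: F_def)
  qed
  then have "(\<integral>\<^sup>+ x. (\<Prod>i\<in>I. indicator {0<..L} (x i)) * h (gap_power_sum \<alpha> L (ordered x I)) \<partial>?P I)
     = (\<integral>\<^sup>+ x. (\<Sum>j\<in>I. F j x) \<partial>?P I)"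
    by (rule nn_integral_cong_AE)
  also have "\<dots> = (\<Sum>j\<in>I. \<integral>\<^sup>+ x. F j x \<partial>?P I)"
    by (rule nn_integral_sum) measurable
  also have "\<dots> = (\<Sum>j\<in>I. \<integral>\<^sup>+ m. indicator {0<..L} m *
        (\<integral>\<^sup>+ x. (\<Prod>i\<in>I - {j}. indicator {0<..m} (x i)) *
           h (gap_power_sum \<alpha> m (ordered x (I - {j})) + \<bar>L - m\<bar> powr \<alpha>) \<partial>?P (I - {j})) \<partial>lborel)"
  proof (rule sum.cong[OF refl])
    fix j assume j: "j \<in> I"
    have ins: "insert j (I - {j}) = I" using j by auto
    \<comment> \<open>Coordinate \<open>j\<close> is integrated outermost, so that \<open>m\<close>
      is the value of the largest point.\<close>
    have "(\<integral>\<^sup>+ x. F j x \<partial>?P I) = (\<integral>\<^sup>+ m. \<integral>\<^sup>+ x. F j (x(j := m)) \<partial>?P (I - {j}) \<partial>lborel)"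
      using lborel_product.product_nn_integral_insert_rev[of "I - {j}" j "F j", unfolded ins] I(1) F_measurable[OF j]
      by simp
    also have "\<dots> = (\<integral>\<^sup>+ m. indicator {0<..L} m *
        (\<integral>\<^sup>+ x. (\<Prod>i\<in>I - {j}. indicator {0<..m} (x i)) *
           h (gap_power_sum \<alpha> m (ordered x (I - {j})) + \<bar>L - m\<bar> powr \<alpha>) \<partial>?P (I - {j})) \<partial>lborel)"
    proof (rule nn_integral_cong)
      fix m :: real
      have "F j (x(j := m)) = indicator {0<..L} m * ((\<Prod>i\<in>I - {j}. indicator {0<..m} (x i)) *
           h (gap_power_sum \<alpha> m (ordered x (I - {j})) + \<bar>L - m\<bar> powr \<alpha>))" for x
      proof -
        have p: "(\<Prod>i\<in>I - {j}. indicator {0<..m} ((x(j := m)) i) :: ennreal) = (\<Prod>i\<in>I - {j}. indicator {0<..m} (x i))"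
          by (intro prod.cong) auto
        show ?thesis
        \<comment> \<open>If \<open>m\<close> dominates, it is the last order statistic and can be
          split off. Otherwise some indicator is zero and both sides vanish, so the unsorted
          configuration is irrelevant.\<close>
        proof (cases "\<forall>i\<in>I - {j}. x i \<le> m")
          case True
          have "ordered (x(j := m)) I = ordered (x(j := m)) (I - {j}) @ [m]"
            using ordered_remove_max[OF I(1) j, of "x(j := m)"] True by auto
          also have "ordered (x(j := m)) (I - {j}) = ordered x (I - {j})"
            by (rule ordered_cong) auto
          finally show ?thesis
            by (simp add: F_def p gap_power_sum_snoc mult.assoc del: fun_upd_apply) (simp add: fun_upd_same)
        next
          case False
          then obtain i where "i \<in> I - {j}" "\<not> x i \<le> m" by auto
          then have "(\<Prod>i\<in>I - {j}. indicator {0<..m} (x i) :: ennreal) = 0"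
            using I(1) by (intro prod_zero bexI[of _ i]) auto
          then show ?thesis by (simp only: F_def p fun_upd_same mult_zero_left mult_zero_right)
        qed
      qed
      then show "(\<integral>\<^sup>+ x. F j (x(j := m)) \<partial>?P (I - {j})) = indicator {0<..L} m *
        (\<integral>\<^sup>+ x. (\<Prod>i\<in>I - {j}. indicator {0<..m} (x i)) *
           h (gap_power_sum \<alpha> m (ordered x (I - {j})) + \<bar>L - m\<bar> powr \<alpha>) \<partial>?P (I - {j}))"
        by (cases "m \<in> {0<..L}") simp_all
    qed
    finally show "(\<integral>\<^sup>+ x. F j x \<partial>?P I) = (\<integral>\<^sup>+ m. indicator {0<..L} m *
        (\<integral>\<^sup>+ x. (\<Prod>i\<in>I - {j}. indicator {0<..m} (x i)) *
           h (gap_power_sum \<alpha> m (ordered x (I - {j})) + \<bar>L - m\<bar> powr \<alpha>) \<partial>?P (I - {j})) \<partial>lborel)" .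
  qed
  finally show ?thesis .
qed

section \<open>Beta integrals on the interval from 0 to \<open>L\<close>\<close>

lemma nn_integral_Beta:
  assumes "a > -1" "b > -1" "L > 0" "(c::real) \<ge> 0"
  shows "(\<integral>\<^sup>+ m. indicator {0<..L} m * ennreal (c * (m powr a * (L - m) powr b)) \<partial>lborel)
    = ennreal (c * Beta (a + 1) (b + 1) * L powr (a + b + 1))"
proof -
  \<comment> \<open>Substitute m = L t. The integrand contributes the power a + b of
    \<open>L\<close> and the Jacobian one more.\<close>
  have "(\<integral>\<^sup>+ m. indicator {0<..L} m * ennreal (c * (m powr a * (L - m) powr b)) \<partial>lborel)
    = \<bar>L\<bar> * (\<integral>\<^sup>+ t. indicator {0<..L} (0 + L * t) * ennreal (c * ((0 + L * t) powr a * (L - (0 + L * t)) powr b)) \<partial>lborel)"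
    using assms(3) by (intro nn_integral_real_affine) auto
  also have "\<dots> = \<bar>L\<bar> * (\<integral>\<^sup>+ t. ennreal (c * L powr (a + b)) * (indicator {0..1} t * ennreal (t powr a * (1 - t) powr b)) \<partial>lborel)"
  proof (rule arg_cong[of _ _ "\<lambda>z. ennreal \<bar>L\<bar> * z"], rule nn_integral_cong)
    fix t :: real
    show "indicator {0<..L} (0 + L * t) * ennreal (c * ((0 + L * t) powr a * (L - (0 + L * t)) powr b))
      = ennreal (c * L powr (a + b)) * (indicator {0..1} t * ennreal (t powr a * (1 - t) powr b))"
    proof (cases "t \<in> {0<..1}")
      case True
      have "L - L * t = L * (1 - t)" by (simp add: algebra_simps)
      then have "c * ((L * t) powr a * (L - L * t) powr b) = (c * L powr (a + b)) * (t powr a * (1 - t) powr b)"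
        using True assms by (simp add: powr_mult powr_add)
      then show ?thesis using True assms by (simp add: zero_less_mult_iff flip: ennreal_mult')
    next
      \<comment> \<open>At t = 0 only the indicator on the right is 1, but
        \<open>0 powr a = 0\<close> for every \<open>a\<close>, so both sides vanish there as
        well.\<close>
      case False
      then show ?thesis using assms by (cases "t = 0") (auto simp: indicator_def zero_less_mult_iff)
    qed
  qed
  also have "\<dots> = \<bar>L\<bar> * (ennreal (c * L powr (a + b)) * (\<integral>\<^sup>+ t. indicator {0..1} t * ennreal (t powr a * (1 - t) powr b) \<partial>lborel))"
    by (subst nn_integral_cmult) simp_all
  also have "(\<integral>\<^sup>+ t. indicator {0..1} t * ennreal (t powr a * (1 - t) powr b) \<partial>lborel) = ennreal (Beta (a + 1) (b + 1))"
    using nn_integral_has_integral_lebesgue[OF _ has_integral_Beta_real[of "a + 1" "b + 1"]] assms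
    by (simp add: ennreal_mult ennreal_indicator)
  also have "\<bar>L\<bar> * (ennreal (c * L powr (a + b)) * ennreal (Beta (a + 1) (b + 1)))
      = ennreal (c * Beta (a + 1) (b + 1) * L powr (a + b + 1))"
    using assms by (simp add: powr_add Beta_def Gamma_real_nonneg flip: ennreal_mult)
  finally show ?thesis .
qed

lemma Beta_1_right: "Beta (a + 1) 1 = 1 / (a + 1)" if "a > -1" for a :: real
proof -
  have "a + 1 \<notin> \<int>\<^sub>\<le>\<^sub>0" using that by (auto elim!: nonpos_Ints_cases)
  moreover have "Gamma (a + 1) > 0" using that by (intro Gamma_real_pos) simp
  ultimately show ?thesis
    using Gamma_plus1[of "a + 1"] by (simp add: Beta_def)
qed

lemma nn_integral_powr_Ioc:
  assumes "a > -1" "L > 0" "(c::real) \<ge> 0"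
  shows "(\<integral>\<^sup>+ m. indicator {0<..L} m * ennreal (c * m powr a) \<partial>lborel) = ennreal (c / (a + 1) * L powr (a + 1))"
proof -
  have "(\<integral>\<^sup>+ m. indicator {0<..L} m * ennreal (c * m powr a) \<partial>lborel)
      = (\<integral>\<^sup>+ m. indicator {0<..L} m * ennreal (c * (m powr a * (L - m) powr 0)) \<partial>lborel)"
    \<comment> \<open>The extra factor \<open>(L - m) powr 0\<close> is 1 except at m = L, where it
      is 0; hence the equality is only almost everywhere.\<close>
    using AE_lborel_singleton[of L] by (intro nn_integral_cong_AE) (auto elim!: eventually_mono)
  then show ?thesis
    using nn_integral_Beta[of a 0 L c] assms by (simp add: Beta_1_right)
qed

section \<open>Moments of gap sums\<close>

text \<open>A single gap of \<open>n\<close> uniform points on the unit interval has \<alpha>-th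
  moment n! \<Gamma>(\<alpha>+1) / \<Gamma>(n+\<alpha>+1), and there are n + 1 gaps.\<close>

definition gap_moment1 :: "real \<Rightarrow> nat \<Rightarrow> real" where
  "gap_moment1 \<alpha> n = (real n + 1) * fact n * Gamma (\<alpha> + 1) / Gamma (real n + \<alpha> + 1)"

text \<open>The gaps are jointly Dirichlet distributed. The n + 1 squares give the term with
  \<Gamma>(2\<alpha>+1), and the n (n + 1) ordered pairs of distinct gaps give the term with
  \<Gamma>(\<alpha>+1)^2.\<close>

definition gap_moment2 :: "real \<Rightarrow> nat \<Rightarrow> real" where
  "gap_moment2 \<alpha> n = (real n + 1) * fact n * (Gamma (2 * \<alpha> + 1) + real n * (Gamma (\<alpha> + 1))\<^sup>2)
     / Gamma (real n + 2 * \<alpha> + 1)"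

section \<open>Recursions satisfied by the closed forms\<close>

lemma Gamma_shift:
  assumes "\<beta> > (0::real)"
  shows "Gamma (real n + 2 + \<beta>) = (real n + 1 + \<beta>) * Gamma (real n + 1 + \<beta>)"
proof -
  have "real n + 1 + \<beta> > 0" using assms by simp
  then have "real n + 1 + \<beta> \<notin> \<int>\<^sub>\<le>\<^sub>0" by (auto elim!: nonpos_Ints_cases)
  then show ?thesis using Gamma_plus1[of "real n + 1 + \<beta>"] by (simp add: add_ac)
qed

lemma gap_moment1_nonneg: "\<alpha> > 0 \<Longrightarrow> gap_moment1 \<alpha> n \<ge> 0"
  by (simp add: gap_moment1_def Gamma_real_nonneg)

lemma gap_moment2_nonneg: "\<alpha> > 0 \<Longrightarrow> gap_moment2 \<alpha> n \<ge> 0"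
  by (simp add: gap_moment2_def Gamma_real_nonneg)

lemma gap_moment1_0 [simp]: "\<alpha> > 0 \<Longrightarrow> gap_moment1 \<alpha> 0 = 1"
  using Gamma_real_pos[of "\<alpha> + 1", THEN less_imp_neq] by (simp add: gap_moment1_def)

lemma gap_moment2_0 [simp]: "\<alpha> > 0 \<Longrightarrow> gap_moment2 \<alpha> 0 = 1"
  using Gamma_real_pos[of "2 * \<alpha> + 1", THEN less_imp_neq] by (simp add: gap_moment2_def)

text \<open>The right side mirrors the conditioning for L = 1: n + 1 choices of the largest point,
  the integral of the moment of the remaining gaps, and the Beta integral of the last gap. Over the
  common denominator \<open>s * X\<close> the numerators add up as n + 1 plus 1.\<close>

lemma gap_moment1_Suc:
  assumes "\<alpha> > 0"
  shows "gap_moment1 \<alpha> (Suc n) =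
    (real n + 1) * (gap_moment1 \<alpha> n / (real n + \<alpha> + 1) + Beta (real n + 1) (\<alpha> + 1))"
proof -
  define X where "X = Gamma (real n + 1 + \<alpha>)"
  define A where "A = Gamma (\<alpha> + 1)"
  define s where "s = real n + 1 + \<alpha>"
  have X: "X > 0" and s: "s > 0" using assms by (auto simp: X_def s_def intro!: Gamma_real_pos)
  have sh: "Gamma (real n + 2 + \<alpha>) = s * X"
    using Gamma_shift[OF assms, of n] by (simp add: X_def s_def)
  have 1: "gap_moment1 \<alpha> (Suc n) = (real n + 2) * ((real n + 1) * fact n) * A / (s * X)"
    using sh by (simp add: gap_moment1_def A_def add_ac)
  have 2: "gap_moment1 \<alpha> n = (real n + 1) * fact n * A / X"
    by (simp add: gap_moment1_def X_def A_def add_ac)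
  have 3: "Beta (real n + 1) (\<alpha> + 1) = fact n * A / (s * X)"
    using sh Gamma_fact[of n, where 'a = real] by (simp add: Beta_def A_def add_ac)
  have 4: "real n + \<alpha> + 1 = s" by (simp add: s_def)
  show ?thesis unfolding 1 2 3 4 using X s by (simp add: divide_simps) (simp add: algebra_simps)
qed

text \<open>The middle term is the cross term of the squared sum. The numerator
  \<Gamma>(n+\<alpha>+1) of its Beta value cancels the denominator of the first moment, so every
  term has denominator \<open>s * X\<close>.\<close>

lemma gap_moment2_Suc:
  assumes "\<alpha> > 0"
  shows "gap_moment2 \<alpha> (Suc n) =
    (real n + 1) * (gap_moment2 \<alpha> n / (real n + 2 * \<alpha> + 1)
      + 2 * gap_moment1 \<alpha> n * Beta (real n + \<alpha> + 1) (\<alpha> + 1) + Beta (real n + 1) (2 * \<alpha> + 1))"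
proof -
  define X where "X = Gamma (real n + 1 + 2 * \<alpha>)"
  define Y where "Y = Gamma (real n + 1 + \<alpha>)"
  define A where "A = Gamma (\<alpha> + 1)"
  define B where "B = Gamma (2 * \<alpha> + 1)"
  define s where "s = real n + 1 + 2 * \<alpha>"
  have X: "X > 0" and Y: "Y > 0" and s: "s > 0" using assms by (auto simp: X_def Y_def s_def intro!: Gamma_real_pos)
  have sh: "Gamma (real n + 2 + 2 * \<alpha>) = s * X"
    using Gamma_shift[of "2 * \<alpha>" n] assms by (simp add: X_def s_def)
  have 1: "gap_moment2 \<alpha> (Suc n) = (real n + 2) * ((real n + 1) * fact n) * (B + (real n + 1) * A\<^sup>2) / (s * X)"
    using sh by (simp add: gap_moment2_def A_def B_def add_ac)
  have 2: "gap_moment2 \<alpha> n = (real n + 1) * fact n * (B + real n * A\<^sup>2) / X"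
    by (simp add: gap_moment2_def X_def A_def B_def add_ac)
  have 3: "gap_moment1 \<alpha> n = (real n + 1) * fact n * A / Y"
    by (simp add: gap_moment1_def Y_def A_def add_ac)
  have 4: "Beta (real n + \<alpha> + 1) (\<alpha> + 1) = Y * A / (s * X)"
    using sh by (simp add: Beta_def Y_def A_def add_ac)
  have 5: "Beta (real n + 1) (2 * \<alpha> + 1) = fact n * B / (s * X)"
    using sh Gamma_fact[of n, where 'a = real] by (simp add: Beta_def B_def add_ac)
  have 6: "real n + 2 * \<alpha> + 1 = s" by (simp add: s_def)
  show ?thesis unfolding 1 2 3 4 5 6 using X Y s
    by (simp add: divide_simps) (simp add: algebra_simps power2_eq_square)
qed

section \<open>Moments as integrals over the cube, by induction on the number of points\<close>

lemma of_nat_Suc_ennreal: "(of_nat (Suc n) :: ennreal) = ennreal (real n + 1)"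
  unfolding ennreal_of_nat_eq_real_of_nat by (simp add: add.commute)

lemma nn_integral_cube:
  assumes "finite I" "L > 0"
  shows "(\<integral>\<^sup>+ x. (\<Prod>i\<in>I. indicator {0<..L} (x i)) \<partial>(\<Pi>\<^sub>M i\<in>I. lborel)) = ennreal (L powr real (card I))"
proof -
  have "(\<integral>\<^sup>+ x. (\<Prod>i\<in>I. indicator {0<..L} (x i)) \<partial>(\<Pi>\<^sub>M i\<in>I. lborel)) = (\<Prod>i\<in>I. \<integral>\<^sup>+ y. indicator {0<..L} y \<partial>lborel)"
    using assms(1) by (intro lborel_product.product_nn_integral_prod) auto
  also have "\<dots> = ennreal (L powr real (card I))"
    using assms by (simp add: ennreal_power powr_realpow)
  finally show ?thesis .
qed

text \<open>The induction keeps \<open>L\<close> arbitrary because the hypothesis is applied on the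
  shorter interval ending at \<open>m\<close>. The integral is not normalised by the volume of the
  cube, which accounts for the summand \<open>card I\<close> in the exponent of
  \<open>L\<close>.\<close>

lemma nn_integral_gap_power_sum:
  assumes "finite I" "\<alpha> > 0" "L > 0"
  shows "(\<integral>\<^sup>+ x. (\<Prod>i\<in>I. indicator {0<..L} (x i)) * ennreal (gap_power_sum \<alpha> L (ordered x I)) \<partial>(\<Pi>\<^sub>M i\<in>I. lborel))
    = ennreal (gap_moment1 \<alpha> (card I) * L powr (real (card I) + \<alpha>))"
  using assms(1,3)
proof (induction "card I" arbitrary: I L)
  case 0
  then have [simp]: "I = {}" by simp
  show ?case using 0 assms(2) by (simp add: PiM_empty nn_integral_count_space_finite gap_power_sum_Nil)
next
  case (Suc n)
  have "I \<noteq> {}" using Suc.hyps(2) by auto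
  have c: "gap_moment1 \<alpha> n \<ge> 0" using assms(2) by (rule gap_moment1_nonneg)
  \<comment> \<open>For a fixed largest point, the induction hypothesis gives the remaining gaps,
    and the last gap is constant in \<open>x\<close>, so it is multiplied by the volume of the
    smaller cube.\<close>
  have inner: "(\<integral>\<^sup>+ x. (\<Prod>i\<in>I - {j}. indicator {0<..m} (x i)) *
           ennreal (gap_power_sum \<alpha> m (ordered x (I - {j})) + \<bar>L - m\<bar> powr \<alpha>) \<partial>(\<Pi>\<^sub>M i\<in>I - {j}. lborel))
      = ennreal (gap_moment1 \<alpha> n * m powr (real n + \<alpha>)) + ennreal (m powr real n * (L - m) powr \<alpha>)"
    (is "?lhs = _") if j: "j \<in> I" and m: "m \<in> {0<..L}" for j m
  proof -
    have card: "card (I - {j}) = n" and fin: "finite (I - {j})" using Suc.hyps(2) j Suc.prems by auto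
    have "?lhs = (\<integral>\<^sup>+ x. (\<Prod>i\<in>I - {j}. indicator {0<..m} (x i)) * ennreal (gap_power_sum \<alpha> m (ordered x (I - {j})))
       + ennreal ((L - m) powr \<alpha>) * (\<Prod>i\<in>I - {j}. indicator {0<..m} (x i)) \<partial>(\<Pi>\<^sub>M i\<in>I - {j}. lborel))"
      using m by (intro nn_integral_cong) (simp add: gap_power_sum_nonneg distrib_left mult.commute)
    also have "\<dots> = (\<integral>\<^sup>+ x. (\<Prod>i\<in>I - {j}. indicator {0<..m} (x i)) * ennreal (gap_power_sum \<alpha> m (ordered x (I - {j}))) \<partial>(\<Pi>\<^sub>M i\<in>I - {j}. lborel))
       + ennreal ((L - m) powr \<alpha>) * (\<integral>\<^sup>+ x. (\<Prod>i\<in>I - {j}. indicator {0<..m} (x i)) \<partial>(\<Pi>\<^sub>M i\<in>I - {j}. lborel))"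
      using fin by (simp add: nn_integral_add nn_integral_cmult)
    also have "\<dots> = ennreal (gap_moment1 \<alpha> n * m powr (real n + \<alpha>)) + ennreal (m powr real n * (L - m) powr \<alpha>)"
      using Suc.hyps(1)[OF card[symmetric] fin, of m] nn_integral_cube[OF fin, of m] m
      by (simp add: card ennreal_mult mult.commute)
    finally show ?thesis .
  qed
  have outer: "(\<integral>\<^sup>+ m. indicator {0<..L} m * (\<integral>\<^sup>+ x. (\<Prod>i\<in>I - {j}. indicator {0<..m} (x i)) *
           ennreal (gap_power_sum \<alpha> m (ordered x (I - {j})) + \<bar>L - m\<bar> powr \<alpha>) \<partial>(\<Pi>\<^sub>M i\<in>I - {j}. lborel)) \<partial>lborel)
      = ennreal ((gap_moment1 \<alpha> n / (real n + \<alpha> + 1) + Beta (real n + 1) (\<alpha> + 1)) * L powr (real n + \<alpha> + 1))"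
    (is "?lhs = _") if j: "j \<in> I" for j
  proof -
    have "?lhs = (\<integral>\<^sup>+ m. indicator {0<..L} m * ennreal (gap_moment1 \<alpha> n * m powr (real n + \<alpha>))
        + indicator {0<..L} m * ennreal (1 * (m powr real n * (L - m) powr \<alpha>)) \<partial>lborel)"
      (is "(\<integral>\<^sup>+ m. ?f m \<partial>lborel) = (\<integral>\<^sup>+ m. ?g m \<partial>lborel)")
    proof (rule nn_integral_cong)
      fix m :: real
      show "?f m = ?g m"
      proof (cases "m \<in> {0<..L}")
        case True
        show ?thesis unfolding inner[OF j True] by (simp add: distrib_left)
      qed simp
    qed
    also have "\<dots> = ennreal (gap_moment1 \<alpha> n / (real n + \<alpha> + 1) * L powr (real n + \<alpha> + 1))
        + ennreal (1 * Beta (real n + 1) (\<alpha> + 1) * L powr (real n + \<alpha> + 1))"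
      using nn_integral_powr_Ioc[of "real n + \<alpha>" L] nn_integral_Beta[of "real n" \<alpha> L 1] c assms(2) \<open>L > 0\<close>
      by (subst nn_integral_add) auto
    also have "\<dots> = ennreal ((gap_moment1 \<alpha> n / (real n + \<alpha> + 1) + Beta (real n + 1) (\<alpha> + 1)) * L powr (real n + \<alpha> + 1))"
      using c assms(2) by (subst ennreal_plus[symmetric]) (auto simp: Beta_def Gamma_real_nonneg distrib_right)
    finally show ?thesis .
  qed
  \<comment> \<open>The value of \<open>outer\<close> does not depend on \<open>j\<close>, so the
    sum over the possible largest points becomes the factor \<open>card I\<close>.\<close>
  have "(\<integral>\<^sup>+ x. (\<Prod>i\<in>I. indicator {0<..L} (x i)) * ennreal (gap_power_sum \<alpha> L (ordered x I)) \<partial>(\<Pi>\<^sub>M i\<in>I. lborel))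
    = of_nat (card I) * ennreal ((gap_moment1 \<alpha> n / (real n + \<alpha> + 1) + Beta (real n + 1) (\<alpha> + 1)) * L powr (real n + \<alpha> + 1))"
    using nn_integral_cube_split_max[OF Suc.prems(1) \<open>I \<noteq> {}\<close>, of ennreal L \<alpha>] outer by simp
  also have "\<dots> = ennreal (gap_moment1 \<alpha> (card I) * L powr (real (card I) + \<alpha>))"
    unfolding Suc.hyps(2)[symmetric] gap_moment1_Suc[OF assms(2)]
    unfolding of_nat_Suc_ennreal by (subst ennreal_mult'[symmetric]) (simp_all add: mult.assoc add_ac)
  finally show ?case .
qed

text \<open>The same induction, with the square of (remaining gaps + last gap) expanded; the cross
  term is evaluated by the first-moment lemma.\<close>

lemma nn_integral_gap_power_sum_squared:
  assumes "finite I" "\<alpha> > 0" "L > 0"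
  shows "(\<integral>\<^sup>+ x. (\<Prod>i\<in>I. indicator {0<..L} (x i)) * ennreal ((gap_power_sum \<alpha> L (ordered x I))\<^sup>2) \<partial>(\<Pi>\<^sub>M i\<in>I. lborel))
    = ennreal (gap_moment2 \<alpha> (card I) * L powr (real (card I) + 2 * \<alpha>))"
  using assms(1,3)
proof (induction "card I" arbitrary: I L)
  case 0
  then have [simp]: "I = {}" by simp
  show ?case using 0 assms(2)
    by (simp add: PiM_empty nn_integral_count_space_finite gap_power_sum_Nil power2_eq_square flip: powr_add)
next
  case (Suc n)
  have "I \<noteq> {}" using Suc.hyps(2) by auto
  have c1: "gap_moment1 \<alpha> n \<ge> 0" and c2: "gap_moment2 \<alpha> n \<ge> 0"
    using assms(2) gap_moment1_nonneg gap_moment2_nonneg by auto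
  have inner: "(\<integral>\<^sup>+ x. (\<Prod>i\<in>I - {j}. indicator {0<..m} (x i)) *
           ennreal ((gap_power_sum \<alpha> m (ordered x (I - {j})) + \<bar>L - m\<bar> powr \<alpha>)\<^sup>2) \<partial>(\<Pi>\<^sub>M i\<in>I - {j}. lborel))
      = ennreal (gap_moment2 \<alpha> n * m powr (real n + 2 * \<alpha>))
        + ennreal (2 * gap_moment1 \<alpha> n * (m powr (real n + \<alpha>) * (L - m) powr \<alpha>))
        + ennreal (m powr real n * (L - m) powr (2 * \<alpha>))"
    (is "?lhs = _") if j: "j \<in> I" and m: "m \<in> {0<..L}" for j m
  proof -
    have card: "card (I - {j}) = n" and fin: "finite (I - {j})" using Suc.hyps(2) j Suc.prems by auto
    define b where "b = (L - m) powr \<alpha>"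
    have b: "b \<ge> 0" "\<bar>L - m\<bar> powr \<alpha> = b" using m by (simp_all add: b_def)
    have sq: "ennreal ((g + b)\<^sup>2) = ennreal (g\<^sup>2) + ennreal (2 * b) * ennreal g + ennreal (b\<^sup>2)" if "g \<ge> 0" for g
    proof -
      have "(g + b)\<^sup>2 = g\<^sup>2 + 2 * b * g + b\<^sup>2" by (simp add: power2_eq_square algebra_simps)
      then show ?thesis using that b by (simp add: ennreal_mult)
    qed
    have "?lhs = (\<integral>\<^sup>+ x. (\<Prod>i\<in>I - {j}. indicator {0<..m} (x i)) * ennreal ((gap_power_sum \<alpha> m (ordered x (I - {j})))\<^sup>2)
       + ennreal (2 * b) * ((\<Prod>i\<in>I - {j}. indicator {0<..m} (x i)) * ennreal (gap_power_sum \<alpha> m (ordered x (I - {j}))))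
       + ennreal (b\<^sup>2) * (\<Prod>i\<in>I - {j}. indicator {0<..m} (x i)) \<partial>(\<Pi>\<^sub>M i\<in>I - {j}. lborel))"
      by (intro nn_integral_cong) (simp add: b(2) sq gap_power_sum_nonneg distrib_left mult_ac del: ennreal_plus)
    also have "\<dots> = (\<integral>\<^sup>+ x. (\<Prod>i\<in>I - {j}. indicator {0<..m} (x i)) * ennreal ((gap_power_sum \<alpha> m (ordered x (I - {j})))\<^sup>2) \<partial>(\<Pi>\<^sub>M i\<in>I - {j}. lborel))
       + ennreal (2 * b) * (\<integral>\<^sup>+ x. (\<Prod>i\<in>I - {j}. indicator {0<..m} (x i)) * ennreal (gap_power_sum \<alpha> m (ordered x (I - {j}))) \<partial>(\<Pi>\<^sub>M i\<in>I - {j}. lborel))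
       + ennreal (b\<^sup>2) * (\<integral>\<^sup>+ x. (\<Prod>i\<in>I - {j}. indicator {0<..m} (x i)) \<partial>(\<Pi>\<^sub>M i\<in>I - {j}. lborel))"
      using fin by (simp add: nn_integral_add nn_integral_cmult)
    also have "\<dots> = ennreal (gap_moment2 \<alpha> n * m powr (real n + 2 * \<alpha>))
        + ennreal (2 * b) * ennreal (gap_moment1 \<alpha> n * m powr (real n + \<alpha>)) + ennreal (b\<^sup>2) * ennreal (m powr real n)"
      using Suc.hyps(1)[OF card[symmetric] fin, of m] nn_integral_gap_power_sum[OF fin assms(2), of m] nn_integral_cube[OF fin, of m] m
      by (simp add: card)
    also have "ennreal (2 * b) * ennreal (gap_moment1 \<alpha> n * m powr (real n + \<alpha>))
       = ennreal (2 * gap_moment1 \<alpha> n * (m powr (real n + \<alpha>) * (L - m) powr \<alpha>))"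
      using b(1) by (subst ennreal_mult'[symmetric]) (simp_all add: b_def mult_ac)
    also have "ennreal (b\<^sup>2) * ennreal (m powr real n) = ennreal (m powr real n * (L - m) powr (2 * \<alpha>))"
      by (subst ennreal_mult'[symmetric]) (simp_all add: b_def mult_ac power2_eq_square flip: powr_add)
    finally show ?thesis .
  qed
  have outer: "(\<integral>\<^sup>+ m. indicator {0<..L} m * (\<integral>\<^sup>+ x. (\<Prod>i\<in>I - {j}. indicator {0<..m} (x i)) *
           ennreal ((gap_power_sum \<alpha> m (ordered x (I - {j})) + \<bar>L - m\<bar> powr \<alpha>)\<^sup>2) \<partial>(\<Pi>\<^sub>M i\<in>I - {j}. lborel)) \<partial>lborel)
      = ennreal ((gap_moment2 \<alpha> n / (real n + 2 * \<alpha> + 1) + 2 * gap_moment1 \<alpha> n * Beta (real n + \<alpha> + 1) (\<alpha> + 1)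
          + Beta (real n + 1) (2 * \<alpha> + 1)) * L powr (real n + 2 * \<alpha> + 1))"
    (is "?lhs = _") if j: "j \<in> I" for j
  proof -
    have "?lhs = (\<integral>\<^sup>+ m. indicator {0<..L} m * ennreal (gap_moment2 \<alpha> n * m powr (real n + 2 * \<alpha>))
        + indicator {0<..L} m * ennreal (2 * gap_moment1 \<alpha> n * (m powr (real n + \<alpha>) * (L - m) powr \<alpha>))
        + indicator {0<..L} m * ennreal (1 * (m powr real n * (L - m) powr (2 * \<alpha>))) \<partial>lborel)"
      (is "(\<integral>\<^sup>+ m. ?f m \<partial>lborel) = (\<integral>\<^sup>+ m. ?g m \<partial>lborel)")
    proof (rule nn_integral_cong)
      fix m :: real
      show "?f m = ?g m"
      proof (cases "m \<in> {0<..L}")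
        case True
        show ?thesis unfolding inner[OF j True] by (simp add: distrib_left)
      qed simp
    qed
    also have "\<dots> = (\<integral>\<^sup>+ m. indicator {0<..L} m * ennreal (gap_moment2 \<alpha> n * m powr (real n + 2 * \<alpha>)) \<partial>lborel)
        + (\<integral>\<^sup>+ m. indicator {0<..L} m * ennreal (2 * gap_moment1 \<alpha> n * (m powr (real n + \<alpha>) * (L - m) powr \<alpha>)) \<partial>lborel)
        + (\<integral>\<^sup>+ m. indicator {0<..L} m * ennreal (1 * (m powr real n * (L - m) powr (2 * \<alpha>))) \<partial>lborel)"
      by (simp add: nn_integral_add)
    also have "(\<integral>\<^sup>+ m. indicator {0<..L} m * ennreal (gap_moment2 \<alpha> n * m powr (real n + 2 * \<alpha>)) \<partial>lborel)
       = ennreal (gap_moment2 \<alpha> n / (real n + 2 * \<alpha> + 1) * L powr (real n + 2 * \<alpha> + 1))"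
      using c2 assms(2) \<open>L > 0\<close> by (intro nn_integral_powr_Ioc) auto
    also have "(\<integral>\<^sup>+ m. indicator {0<..L} m * ennreal (2 * gap_moment1 \<alpha> n * (m powr (real n + \<alpha>) * (L - m) powr \<alpha>)) \<partial>lborel)
       = ennreal (2 * gap_moment1 \<alpha> n * Beta (real n + \<alpha> + 1) (\<alpha> + 1) * L powr (real n + \<alpha> + \<alpha> + 1))"
      using c1 assms(2) \<open>L > 0\<close> by (intro nn_integral_Beta) auto
    also have "(\<integral>\<^sup>+ m. indicator {0<..L} m * ennreal (1 * (m powr real n * (L - m) powr (2 * \<alpha>))) \<partial>lborel)
       = ennreal (1 * Beta (real n + 1) (2 * \<alpha> + 1) * L powr (real n + 2 * \<alpha> + 1))"
      using assms(2) \<open>L > 0\<close> by (intro nn_integral_Beta) auto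
    also have "real n + \<alpha> + \<alpha> + 1 = real n + 2 * \<alpha> + 1" by simp
    finally show ?thesis
      using c1 c2 assms(2) by (simp add: Beta_def Gamma_real_nonneg distrib_right flip: ennreal_plus)
  qed
  have "(\<integral>\<^sup>+ x. (\<Prod>i\<in>I. indicator {0<..L} (x i)) * ennreal ((gap_power_sum \<alpha> L (ordered x I))\<^sup>2) \<partial>(\<Pi>\<^sub>M i\<in>I. lborel))
    = of_nat (card I) * ennreal ((gap_moment2 \<alpha> n / (real n + 2 * \<alpha> + 1) + 2 * gap_moment1 \<alpha> n * Beta (real n + \<alpha> + 1) (\<alpha> + 1)
          + Beta (real n + 1) (2 * \<alpha> + 1)) * L powr (real n + 2 * \<alpha> + 1))"
    using nn_integral_cube_split_max[OF Suc.prems(1) \<open>I \<noteq> {}\<close>, of "\<lambda>y. ennreal (y\<^sup>2)" L \<alpha>] outer by simp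
  also have "\<dots> = ennreal (gap_moment2 \<alpha> (card I) * L powr (real (card I) + 2 * \<alpha>))"
    unfolding Suc.hyps(2)[symmetric] gap_moment2_Suc[OF assms(2)]
    unfolding of_nat_Suc_ennreal by (subst ennreal_mult'[symmetric]) (simp_all add: mult.assoc add_ac)
  finally show ?case .
qed

section \<open>Gamma quotients\<close>

text \<open>This is Euler's limit for \<Gamma>(z), divided by \<Gamma>(z), with the Pochhammer
  symbol rewritten as \<Gamma>(n+z+1) / \<Gamma>(z).\<close>

lemma Gamma_ratio_LIMSEQ:
  assumes "z > (0::real)"
  shows "(\<lambda>n. fact n * real n powr z / Gamma (real n + z + 1)) \<longlonglongrightarrow> 1"
proof -
  have nz: "z \<notin> \<int>\<^sub>\<le>\<^sub>0" using assms by (auto elim!: nonpos_Ints_cases)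
  have "(\<lambda>n. Gamma_series z n / Gamma z) \<longlonglongrightarrow> Gamma z / Gamma z"
    using Gamma_real_pos[OF assms] by (intro tendsto_divide Gamma_series_LIMSEQ tendsto_const) simp
  moreover have "\<forall>\<^sub>F n in sequentially. Gamma_series z n / Gamma z = fact n * real n powr z / Gamma (real n + z + 1)"
    using eventually_gt_at_top[of 0]
  proof eventually_elim
    case (elim n)
    then show ?case using Gamma_real_pos[OF assms]
      by (simp add: Gamma_series_def pochhammer_Gamma[OF nz] powr_def add_ac)
  qed
  ultimately show ?thesis
    using Gamma_real_pos[OF assms] by (auto intro: Lim_transform_eventually)
qed

text \<open>
  Both bounds come from sequences that are monotone with limit \<open>1\<close>, because the consecutive
  quotients of \<open>\<Gamma>(n+\<alpha>+1)\<^sup>2 / (n! \<Gamma>(n+2\<alpha>+1))\<close> are \<open>1 + \<alpha>\<^sup>2 / ((n+1)(n+1+2\<alpha>))\<close>.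
\<close>
lemma Gamma_quotient_second_order:
  assumes "\<alpha> > (0::real)"
  defines "w \<equiv> \<lambda>n::nat. (Gamma (real n + \<alpha> + 1))\<^sup>2 / (fact n * Gamma (real n + 2 * \<alpha> + 1))"
  shows "(\<lambda>n. real n * (1 - w n)) \<longlonglongrightarrow> \<alpha>\<^sup>2"
proof -
  have g1: "Gamma (real n + \<alpha> + 1) > 0" and g2: "Gamma (real n + 2 * \<alpha> + 1) > 0" for n
    using assms(1) by (auto intro!: Gamma_real_pos)
  have w_pos: "w n > 0" for n
    using g1[of n] g2[of n] by (simp add: w_def)
  have nz: "x \<notin> \<int>\<^sub>\<le>\<^sub>0" if "x > 0" for x :: real
    using that by (auto elim!: nonpos_Ints_cases)
  have w_Suc: "w (Suc n) = w n * (1 + \<alpha>\<^sup>2 / ((real n + 1) * (real n + 1 + 2 * \<alpha>)))" for n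
  proof -
    have 1: "Gamma (real (Suc n) + \<alpha> + 1) = (real n + \<alpha> + 1) * Gamma (real n + \<alpha> + 1)"
      using Gamma_plus1[of "real n + \<alpha> + 1"] nz[of "real n + \<alpha> + 1"] assms(1) by (simp add: add_ac)
    have 2: "Gamma (real (Suc n) + 2 * \<alpha> + 1) = (real n + 2 * \<alpha> + 1) * Gamma (real n + 2 * \<alpha> + 1)"
      using Gamma_plus1[of "real n + 2 * \<alpha> + 1"] nz[of "real n + 2 * \<alpha> + 1"] assms(1) by (simp add: add_ac)
    \<comment> \<open>This is (x+\<alpha>)^2 = x (x+2\<alpha>) + \<alpha>^2 at x = n + 1.\<close>
    have "1 + \<alpha>\<^sup>2 / ((real n + 1) * (real n + 1 + 2 * \<alpha>)) = (real n + \<alpha> + 1)\<^sup>2 / ((real n + 1) * (real n + 2 * \<alpha> + 1))"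
      using assms(1) by (simp add: field_simps power2_eq_square add_nonneg_eq_0_iff)
    then show ?thesis
      unfolding w_def 1 2 using g2[of n] by (simp add: power_mult_distrib mult_ac add_ac)
  qed
  have w_lim: "w \<longlonglongrightarrow> 1"
  proof -
    have "(\<lambda>n. (fact n * real n powr (2 * \<alpha>) / Gamma (real n + 2 * \<alpha> + 1)) /
               (fact n * real n powr \<alpha> / Gamma (real n + \<alpha> + 1))\<^sup>2) \<longlonglongrightarrow> 1 / 1\<^sup>2"
      using assms(1) by (intro tendsto_intros Gamma_ratio_LIMSEQ) auto
    moreover have "\<forall>\<^sub>F n in sequentially.
        (fact n * real n powr (2 * \<alpha>) / Gamma (real n + 2 * \<alpha> + 1)) /
               (fact n * real n powr \<alpha> / Gamma (real n + \<alpha> + 1))\<^sup>2 = w n"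
      using eventually_gt_at_top[of 0]
    proof eventually_elim
      case (elim n)
      have "real n powr (2 * \<alpha>) = (real n powr \<alpha>)\<^sup>2" by (simp add: power2_eq_square flip: powr_add)
      then show ?case using elim g1[of n] g2[of n]
        by (simp add: w_def power_mult_distrib power_divide) (simp add: field_simps power2_eq_square)
    qed
    ultimately show ?thesis by (auto intro: Lim_transform_eventually)
  qed
  have upper: "real n * (1 - w n) \<le> \<alpha>\<^sup>2" if n: "real n > \<alpha>\<^sup>2" for n
  proof -
    \<comment> \<open>The correction factor is 1 / (1 - \<alpha>^2/y) at y = n + k. As
      \<open>h\<close> decreases to 1, its first term is at least 1, which says \<open>w n\<close>
      \<ge> 1 - \<alpha>^2/n. The assumption on \<open>n\<close> keeps the denominators
      positive.\<close>
    define h where "h k = w (n + k) * (real (n + k) / (real (n + k) - \<alpha>\<^sup>2))" for k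
    have "decseq h"
    proof (rule decseq_SucI)
      fix k
      define y where "y = real (n + k)"
      have y: "y > \<alpha>\<^sup>2" "y > 0" "y + 1 - \<alpha>\<^sup>2 > 0" using n zero_le_power2[of \<alpha>] unfolding y_def by linarith+
      have "(1 + \<alpha>\<^sup>2 / ((y + 1) * (y + 1 + 2 * \<alpha>))) * ((y + 1) / (y + 1 - \<alpha>\<^sup>2)) \<le> y / (y - \<alpha>\<^sup>2)"
      proof -
        \<comment> \<open>Dropping 2\<alpha> enlarges the quotient of \<open>w\<close>; the quotient
          of the correction factors still exceeds it, by an explicit nonnegative remainder.\<close>
        have "(1 + \<alpha>\<^sup>2 / ((y + 1) * (y + 1 + 2 * \<alpha>))) \<le> (1 + \<alpha>\<^sup>2 / ((y + 1) * y))"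
          using y assms(1) by (intro add_left_mono divide_left_mono mult_left_mono) auto
        also have "\<dots> \<le> y / (y - \<alpha>\<^sup>2) / ((y + 1) / (y + 1 - \<alpha>\<^sup>2))"
        proof -
          have "y / (y - \<alpha>\<^sup>2) / ((y + 1) / (y + 1 - \<alpha>\<^sup>2)) - (1 + \<alpha>\<^sup>2 / ((y + 1) * y))
             = (\<alpha>\<^sup>2)\<^sup>2 / ((y - \<alpha>\<^sup>2) * (y + 1) * y)"
            using y by (simp add: divide_simps) (simp add: algebra_simps power2_eq_square power4_eq_xxxx)
          also have "\<dots> \<ge> 0" using y by simp
          finally show ?thesis by simp
        qed
        finally show ?thesis using y by (subst (asm) pos_le_divide_eq) auto
      qed
      then have "w (n + k) * ((1 + \<alpha>\<^sup>2 / ((y + 1) * (y + 1 + 2 * \<alpha>))) * ((y + 1) / (y + 1 - \<alpha>\<^sup>2)))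
         \<le> w (n + k) * (y / (y - \<alpha>\<^sup>2))"
        using w_pos[of "n + k"] by (intro mult_left_mono) auto
      moreover have "w (n + Suc k) = w (n + k) * (1 + \<alpha>\<^sup>2 / ((y + 1) * (y + 1 + 2 * \<alpha>)))"
        using w_Suc[of "n + k"] by (simp add: y_def)
      moreover have "real (n + Suc k) = y + 1" by (simp add: y_def)
      ultimately show "h (Suc k) \<le> h k"
        unfolding h_def by (simp only: y_def[symmetric] mult.assoc)
    qed
    moreover have "h \<longlonglongrightarrow> 1 * 1"
      unfolding h_def
    proof (intro tendsto_mult)
      show "(\<lambda>k. w (n + k)) \<longlonglongrightarrow> 1"
        using LIMSEQ_ignore_initial_segment[OF w_lim, of n] by (simp add: add.commute)
      have "(\<lambda>k. real k / (real k - \<alpha>\<^sup>2)) \<longlonglongrightarrow> 1" by real_asymp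
      then show "(\<lambda>k. real (n + k) / (real (n + k) - \<alpha>\<^sup>2)) \<longlonglongrightarrow> 1"
        unfolding add.commute[of n] by (rule LIMSEQ_ignore_initial_segment)
    qed
    ultimately have "h 0 \<ge> 1" using decseq_ge by fastforce
    then show ?thesis using n w_pos[of n] by (simp add: h_def field_simps)
  qed
  have lower: "real n * (1 - w n) \<ge> real n * \<alpha>\<^sup>2 / (real n + 1 + \<alpha> + \<alpha>\<^sup>2)" for n
  proof -
    \<comment> \<open>The correction factor is 1 + \<alpha>^2/(k+1+\<alpha>). As \<open>g\<close>
      increases to 1, every term is at most 1, and solving for \<open>w n\<close> gives the upper
      bound 1 - \<alpha>^2/(n+1+\<alpha>+\<alpha>^2).\<close>
    define g where "g k = w k * ((real k + 1 + \<alpha> + \<alpha>\<^sup>2) / (real k + 1 + \<alpha>))" for k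
    have "incseq g"
    proof (rule incseq_SucI)
      fix k
      define y where "y = real k"
      have y: "y \<ge> 0" by (simp add: y_def)
      define a where "a = \<alpha>\<^sup>2"
      have a: "a > 0" using assms(1) by (simp add: a_def)
      have "((y + 1 + \<alpha> + a) / (y + 1 + \<alpha>)) / ((y + 2 + \<alpha> + a) / (y + 2 + \<alpha>))
          \<le> 1 + a / ((y + 1) * (y + 1 + 2 * \<alpha>))"
      proof -
        \<comment> \<open>The product (y+1)(y+1+2\<alpha>) is the square of y+1+\<alpha> minus
          \<alpha>^2. This explains the shift by \<alpha> in the correction factor.\<close>
        have "1 + a / ((y + 1) * (y + 1 + 2 * \<alpha>)) \<ge> 1 + a / ((y + 1 + \<alpha>) * (y + 1 + \<alpha>))"
        proof (intro add_left_mono divide_left_mono)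
          show "(y + 1) * (y + 1 + 2 * \<alpha>) \<le> (y + 1 + \<alpha>) * (y + 1 + \<alpha>)"
            by (simp add: algebra_simps)
        qed (use y a assms(1) in \<open>auto intro!: mult_pos_pos\<close>)
        moreover have "((y + 1 + \<alpha> + a) / (y + 1 + \<alpha>)) / ((y + 2 + \<alpha> + a) / (y + 2 + \<alpha>))
           = 1 + a / ((y + 1 + \<alpha>) * (y + 2 + \<alpha> + a))"
        proof -
          have "y + 1 + \<alpha> > 0" "y + 2 + \<alpha> > 0" "y + 2 + \<alpha> + a > 0" using y a assms(1) by linarith+
          then show ?thesis by (simp add: divide_simps) (simp add: algebra_simps)
        qed
        moreover have "a / ((y + 1 + \<alpha>) * (y + 2 + \<alpha> + a)) \<le> a / ((y + 1 + \<alpha>) * (y + 1 + \<alpha>))"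
          using y a assms(1) by (intro divide_left_mono mult_left_mono) auto
        ultimately show ?thesis by linarith
      qed
      then have "(y + 1 + \<alpha> + a) / (y + 1 + \<alpha>) \<le> (1 + a / ((y + 1) * (y + 1 + 2 * \<alpha>))) * ((y + 2 + \<alpha> + a) / (y + 2 + \<alpha>))"
        using y a assms(1) by (subst (asm) pos_divide_le_eq) auto
      then have "w k * ((y + 1 + \<alpha> + a) / (y + 1 + \<alpha>)) \<le> w k * ((1 + a / ((y + 1) * (y + 1 + 2 * \<alpha>))) * ((y + 2 + \<alpha> + a) / (y + 2 + \<alpha>)))"
        using w_pos[of k] by (intro mult_left_mono) auto
      moreover have "real (Suc k) + 1 = y + 2" by (simp add: y_def)
      ultimately show "g k \<le> g (Suc k)"
        unfolding g_def w_Suc a_def[symmetric] by (simp only: y_def[symmetric] mult.assoc)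
    qed
    moreover have "g \<longlonglongrightarrow> 1 * 1"
      unfolding g_def
    proof (intro tendsto_mult w_lim)
      show "(\<lambda>k. (real k + 1 + \<alpha> + \<alpha>\<^sup>2) / (real k + 1 + \<alpha>)) \<longlonglongrightarrow> 1" by real_asymp
    qed
    ultimately have "g n \<le> 1" using incseq_le by fastforce
    define b where "b = real n + 1 + \<alpha> + \<alpha>\<^sup>2"
    have b: "b > 0" using assms(1) by (simp add: b_def add_pos_nonneg)
    have "w n * b \<le> b - \<alpha>\<^sup>2"
      using \<open>g n \<le> 1\<close> assms(1) by (simp add: g_def b_def field_simps)
    then have "\<alpha>\<^sup>2 / b \<le> 1 - w n" using b by (simp add: field_simps)
    then have "real n * (\<alpha>\<^sup>2 / b) \<le> real n * (1 - w n)" by (intro mult_left_mono) auto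
    then show ?thesis by (simp add: b_def)
  qed
  show ?thesis
  proof (rule tendsto_sandwich)
    show "(\<lambda>n. real n * \<alpha>\<^sup>2 / (real n + 1 + \<alpha> + \<alpha>\<^sup>2)) \<longlonglongrightarrow> \<alpha>\<^sup>2" by real_asymp
    show "\<forall>\<^sub>F n in sequentially. real n * (1 - w n) \<le> \<alpha>\<^sup>2"
      using filterlim_real_sequentially[unfolded filterlim_at_top_dense, rule_format, of "\<alpha>\<^sup>2"]
      by eventually_elim (rule upper)
    show "\<forall>\<^sub>F n in sequentially. real n * \<alpha>\<^sup>2 / (real n + 1 + \<alpha> + \<alpha>\<^sup>2) \<le> real n * (1 - w n)"
      using lower by simp
  qed (rule tendsto_const)
qed

section \<open>Uniform samples\<close>

lemma sample_fermat_dist_1d_nonneg: "sample_fermat_dist_1d \<alpha> n x \<ge> 0"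
  by (simp add: sample_fermat_dist_1d_def sum_nonneg)

text \<open>Both measures agree on boxes, where the integral factorises. Removing 0 from the closed
  interval changes each factor only on a null set and matches the half-open cubes used for the
  moments.\<close>

lemma PiM_uniform_measure_unit_interval:
  assumes "finite I"
  shows "(\<Pi>\<^sub>M i\<in>I. uniform_measure lborel {0..1::real})
    = density (\<Pi>\<^sub>M i\<in>I. lborel) (\<lambda>x. \<Prod>i\<in>I. indicator {0<..1} (x i))"
proof -
  have prob: "prob_space (uniform_measure lborel {0..1::real})"
    by (rule prob_space_uniform_measure) auto
  interpret uniform_product: product_sigma_finite "\<lambda>_. uniform_measure lborel {0..1::real}"
    by (intro product_sigma_finite.intro prob_space_imp_sigma_finite prob)
  show ?thesis
  proof (rule uniform_product.PiM_eqI[symmetric])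
    show "sets (density (\<Pi>\<^sub>M i\<in>I. lborel) (\<lambda>x. \<Prod>i\<in>I. indicator {0<..1::real} (x i)))
      = sets (\<Pi>\<^sub>M i\<in>I. uniform_measure lborel {0..1::real})"
      unfolding sets_density by (rule sets_PiM_cong) auto
    fix A :: "'a \<Rightarrow> real set"
    assume A: "\<And>i. i \<in> I \<Longrightarrow> A i \<in> sets (uniform_measure lborel {0..1})"
    have PiE: "Pi\<^sub>E I A \<in> sets (\<Pi>\<^sub>M i\<in>I. lborel)"
      using A assms by (intro sets_PiM_I_finite) auto
    have "emeasure (density (\<Pi>\<^sub>M i\<in>I. lborel) (\<lambda>x. \<Prod>i\<in>I. indicator {0<..1::real} (x i))) (Pi\<^sub>E I A)
      = (\<integral>\<^sup>+ x. (\<Prod>i\<in>I. indicator {0<..1} (x i)) * indicator (Pi\<^sub>E I A) x \<partial>(\<Pi>\<^sub>M i\<in>I. lborel))"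
      using PiE assms by (intro emeasure_density) auto
    also have "\<dots> = (\<integral>\<^sup>+ x. (\<Prod>i\<in>I. indicator ({0<..1} \<inter> A i) (x i)) \<partial>(\<Pi>\<^sub>M i\<in>I. lborel))"
    proof (rule nn_integral_cong)
      fix x :: "'a \<Rightarrow> real" assume "x \<in> space (\<Pi>\<^sub>M i\<in>I. lborel)"
      then have "indicator (Pi\<^sub>E I A) x = (\<Prod>i\<in>I. indicator (A i) (x i) :: ennreal)"
        using assms by (auto simp: space_PiM indicator_def PiE_def Pi_def)
      then show "(\<Prod>i\<in>I. indicator {0<..1} (x i)) * indicator (Pi\<^sub>E I A) x
          = (\<Prod>i\<in>I. indicator ({0<..1} \<inter> A i) (x i) :: ennreal)"
        by (simp add: prod.distrib indicator_inter_arith)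
    qed
    also have "\<dots> = (\<Prod>i\<in>I. \<integral>\<^sup>+ y. indicator ({0<..1} \<inter> A i) y \<partial>lborel)"
      using A assms by (intro lborel_product.product_nn_integral_prod) auto
    also have "\<dots> = (\<Prod>i\<in>I. emeasure (uniform_measure lborel {0..1}) (A i))"
    proof (rule prod.cong[OF refl])
      fix i assume "i \<in> I"
      then have [measurable]: "A i \<in> sets borel" using A[of i] by simp
      have "(\<integral>\<^sup>+ y. indicator ({0<..1} \<inter> A i) y \<partial>lborel) = (\<integral>\<^sup>+ y. indicator ({0..1} \<inter> A i) y \<partial>lborel)"
        using AE_lborel_singleton[of "0::real"]
        by (intro nn_integral_cong_AE) (auto elim!: eventually_mono simp: indicator_def)
      then show "(\<integral>\<^sup>+ y. indicator ({0<..1} \<inter> A i) y \<partial>lborel) = emeasure (uniform_measure lborel {0..1}) (A i)"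
        by (simp add: divide_ennreal_def)
    qed
    finally show "emeasure (density (\<Pi>\<^sub>M i\<in>I. lborel) (\<lambda>x. \<Prod>i\<in>I. indicator {0<..1::real} (x i))) (Pi\<^sub>E I A)
      = (\<Prod>i\<in>I. emeasure (uniform_measure lborel {0..1}) (A i))" .
  qed fact
qed

section \<open>Moments of the Fermat distance for one fixed sample size\<close>

context
  fixes M :: "'a measure" and q :: "nat \<Rightarrow> 'a \<Rightarrow> real" and n :: nat
  assumes M: "prob_space M"
    and n: "n \<ge> 1"
    and indep: "prob_space.indep_vars M (\<lambda>_. borel) q {1..n}"
    and unif: "\<And>i. i \<in> {1..n} \<Longrightarrow> distr M borel (q i) = uniform_measure lborel {0..1}"
begin

lemma measurable_points: "i \<in> {1..n} \<Longrightarrow> q i \<in> borel_measurable M"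
  using indep by (simp add: prob_space.indep_vars_def[OF M])

lemma measurable_point_tuple [measurable]: "(\<lambda>\<omega>. \<lambda>i\<in>{1..n}. q i \<omega>) \<in> measurable M (\<Pi>\<^sub>M i\<in>{1..n}. borel)"
  by (rule measurable_restrict) (rule measurable_points)

lemma distr_point_tuple:
  "distr M (\<Pi>\<^sub>M i\<in>{1..n}. borel) (\<lambda>\<omega>. \<lambda>i\<in>{1..n}. q i \<omega>)
    = density (\<Pi>\<^sub>M i\<in>{1..n}. lborel) (\<lambda>x. \<Prod>i\<in>{1..n}. indicator {0<..1} (x i))"
proof -
  have "distr M (\<Pi>\<^sub>M i\<in>{1..n}. borel) (\<lambda>\<omega>. \<lambda>i\<in>{1..n}. q i \<omega>) = (\<Pi>\<^sub>M i\<in>{1..n}. distr M borel (q i))"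
    \<comment> \<open>Independence means that the joint law is the product of the marginals;
      \<open>n\<close> supplies a nonempty index set.\<close>
    using prob_space.indep_vars_iff_distr_eq_PiM'[OF M, where I = "{1..n}" and M' = "\<lambda>_. borel" and X = q] n indep measurable_points
    by simp
  also have "\<dots> = (\<Pi>\<^sub>M i\<in>{1..n}. uniform_measure lborel {0..1})"
    using unif by (intro PiM_cong) auto
  finally show ?thesis by (simp add: PiM_uniform_measure_unit_interval)
qed

lemma measurable_gap_power_sum_borel [measurable]:
  "(\<lambda>x. gap_power_sum \<alpha> 1 (ordered x {1..n})) \<in> borel_measurable (\<Pi>\<^sub>M i\<in>{1..n}. borel)"
proof -
  have "sets (\<Pi>\<^sub>M i\<in>{1..n}. lborel :: real measure) = sets (\<Pi>\<^sub>M i\<in>{1..n}. borel)"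
    by (rule sets_PiM_cong) auto
  from measurable_cong_sets[OF this refl] show ?thesis
    using measurable_gap_power_sum[of "{1..n}" \<alpha> 1] by simp
qed

lemma sample_fermat_dist_1d_restrict:
  "sample_fermat_dist_1d \<alpha> n (\<lambda>i. q i \<omega>) = gap_power_sum \<alpha> 1 (ordered (\<lambda>i\<in>{1..n}. q i \<omega>) {1..n})"
  unfolding sample_fermat_dist_1d_eq by (rule arg_cong[OF ordered_cong]) simp

lemma measurable_sample_fermat_dist_1d [measurable]:
  "(\<lambda>\<omega>. sample_fermat_dist_1d \<alpha> n (\<lambda>i. q i \<omega>)) \<in> borel_measurable M"
  unfolding sample_fermat_dist_1d_restrict by measurable

lemma nn_integral_sample_fermat_dist_1d:
  assumes [measurable]: "h \<in> borel_measurable borel"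
  shows "(\<integral>\<^sup>+ \<omega>. h (sample_fermat_dist_1d \<alpha> n (\<lambda>i. q i \<omega>)) \<partial>M)
    = (\<integral>\<^sup>+ x. (\<Prod>i\<in>{1..n}. indicator {0<..1} (x i)) * h (gap_power_sum \<alpha> 1 (ordered x {1..n})) \<partial>(\<Pi>\<^sub>M i\<in>{1..n}. lborel))"
proof -
  have "(\<integral>\<^sup>+ \<omega>. h (sample_fermat_dist_1d \<alpha> n (\<lambda>i. q i \<omega>)) \<partial>M)
    = (\<integral>\<^sup>+ x. h (gap_power_sum \<alpha> 1 (ordered x {1..n})) \<partial>distr M (\<Pi>\<^sub>M i\<in>{1..n}. borel) (\<lambda>\<omega>. \<lambda>i\<in>{1..n}. q i \<omega>))"
    unfolding sample_fermat_dist_1d_restrict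
    by (rule nn_integral_distr[OF measurable_point_tuple, of "\<lambda>x. h (gap_power_sum \<alpha> 1 (ordered x {1..n}))", symmetric]) measurable
  then show ?thesis
    unfolding distr_point_tuple by (subst (asm) nn_integral_density) auto
qed

text \<open>A finite value of the nonnegative integral yields integrability and the expectation at
  once.\<close>

lemma has_bochner_integral_sample_fermat_dist_1d:
  assumes "\<alpha> > 0"
  shows "has_bochner_integral M (\<lambda>\<omega>. sample_fermat_dist_1d \<alpha> n (\<lambda>i. q i \<omega>)) (gap_moment1 \<alpha> n)"
proof (rule has_bochner_integral_nn_integral)
  show "(\<integral>\<^sup>+ \<omega>. ennreal (sample_fermat_dist_1d \<alpha> n (\<lambda>i. q i \<omega>)) \<partial>M) = ennreal (gap_moment1 \<alpha> n)"
    using nn_integral_gap_power_sum[of "{1..n}" \<alpha> 1] assms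
    by (subst nn_integral_sample_fermat_dist_1d) auto
qed (use gap_moment1_nonneg[OF assms] in \<open>auto simp: sample_fermat_dist_1d_nonneg\<close>)

lemma has_bochner_integral_sample_fermat_dist_1d_squared:
  assumes "\<alpha> > 0"
  shows "has_bochner_integral M (\<lambda>\<omega>. (sample_fermat_dist_1d \<alpha> n (\<lambda>i. q i \<omega>))\<^sup>2) (gap_moment2 \<alpha> n)"
proof (rule has_bochner_integral_nn_integral)
  show "(\<integral>\<^sup>+ \<omega>. ennreal ((sample_fermat_dist_1d \<alpha> n (\<lambda>i. q i \<omega>))\<^sup>2) \<partial>M) = ennreal (gap_moment2 \<alpha> n)"
    using nn_integral_gap_power_sum_squared[of "{1..n}" \<alpha> 1] assms
    by (subst nn_integral_sample_fermat_dist_1d) auto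
qed (use gap_moment2_nonneg[OF assms] in auto)

lemma expectation_scaled_sample_fermat_dist_1d:
  assumes "\<alpha> > 0"
  shows "prob_space.expectation M (\<lambda>\<omega>. c * sample_fermat_dist_1d \<alpha> n (\<lambda>i. q i \<omega>)) = c * gap_moment1 \<alpha> n"
  using has_bochner_integral_sample_fermat_dist_1d[OF assms]
  by (simp add: has_bochner_integral_integral_eq)

lemma variance_scaled_sample_fermat_dist_1d:
  assumes "\<alpha> > 0"
  shows "prob_space.variance M (\<lambda>\<omega>. c * sample_fermat_dist_1d \<alpha> n (\<lambda>i. q i \<omega>))
    = c\<^sup>2 * (gap_moment2 \<alpha> n - (gap_moment1 \<alpha> n)\<^sup>2)"
proof -
  note 1 = has_bochner_integral_sample_fermat_dist_1d[OF assms]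
  note 2 = has_bochner_integral_sample_fermat_dist_1d_squared[OF assms]
  show ?thesis
    by (subst prob_space.variance_eq[OF M])
       (use 1 2 in \<open>auto simp: power_mult_distrib has_bochner_integral_iff right_diff_distrib\<close>)
qed

end

section \<open>Passage to the limit\<close>

theorem proposition4p1:
  fixes \<alpha> :: real
    and M :: "nat \<Rightarrow> 'a measure"
    and q :: "nat \<Rightarrow> nat \<Rightarrow> 'a \<Rightarrow> real"
  assumes "\<alpha> \<ge> 1"
    and "\<And>n. n \<ge> 1 \<Longrightarrow> prob_space (M n)"
    and "\<And>n. n \<ge> 1 \<Longrightarrow> prob_space.indep_vars (M n) (\<lambda>_. borel) (q n) {1..n}"
    and "\<And>n i. n \<ge> 1 \<Longrightarrow> i \<in> {1..n} \<Longrightarrow>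
           distr (M n) borel (q n i) = uniform_measure lborel {0..1}"
  shows "(\<lambda>n. prob_space.expectation (M n)
            (\<lambda>\<omega>. real n powr (\<alpha> - 1) * sample_fermat_dist_1d \<alpha> n (\<lambda>i. q n i \<omega>)))
           \<longlonglongrightarrow> Gamma (\<alpha> + 1)
       \<and> (\<lambda>n. real n * prob_space.variance (M n)
            (\<lambda>\<omega>. real n powr (\<alpha> - 1) * sample_fermat_dist_1d \<alpha> n (\<lambda>i. q n i \<omega>)))
           \<longlonglongrightarrow> Gamma (2 * \<alpha> + 1) - (\<alpha>\<^sup>2 + 1) * (Gamma (\<alpha> + 1))\<^sup>2"
proof
  have pos: "\<alpha> > 0" using assms(1) by simp
  define R where "R z n = fact n * real n powr z / Gamma (real n + z + 1)" for z n
  define w where "w n = (Gamma (real n + \<alpha> + 1))\<^sup>2 / (fact n * Gamma (real n + 2 * \<alpha> + 1))" for n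
  have R: "R z \<longlonglongrightarrow> 1" if "z > 0" for z
    unfolding R_def using Gamma_ratio_LIMSEQ[OF that] .
  have w: "(\<lambda>n. real n * (1 - w n)) \<longlonglongrightarrow> \<alpha>\<^sup>2"
    unfolding w_def using Gamma_quotient_second_order[OF pos] .
  have quot: "(\<lambda>n. (real n + 1) / real n) \<longlonglongrightarrow> 1" by real_asymp
  have g: "Gamma (real n + z + 1) > 0" if "z > 0" for z n
    using that by (intro Gamma_real_pos) auto
  have powr1: "real n powr (z - 1) = real n powr z / real n" if "n \<ge> 1" for z n
    using that by (simp add: powr_diff)

  have "(\<lambda>n. Gamma (\<alpha> + 1) * ((real n + 1) / real n) * R \<alpha> n) \<longlonglongrightarrow> Gamma (\<alpha> + 1) * 1 * 1"
    by (intro tendsto_mult tendsto_const quot R pos)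
  moreover have "\<forall>\<^sub>F n in sequentially. Gamma (\<alpha> + 1) * ((real n + 1) / real n) * R \<alpha> n
      = prob_space.expectation (M n)
            (\<lambda>\<omega>. real n powr (\<alpha> - 1) * sample_fermat_dist_1d \<alpha> n (\<lambda>i. q n i \<omega>))"
    using eventually_ge_at_top[of 1]
  \<comment> \<open>The restriction to n \<ge> 1 also matters for the hypotheses, which say nothing
    about \<open>M 0\<close>.\<close>
  proof eventually_elim
    case (elim n)
    have "prob_space.expectation (M n)
            (\<lambda>\<omega>. real n powr (\<alpha> - 1) * sample_fermat_dist_1d \<alpha> n (\<lambda>i. q n i \<omega>))
        = real n powr (\<alpha> - 1) * gap_moment1 \<alpha> n"
      by (rule expectation_scaled_sample_fermat_dist_1d[OF assms(2)[OF elim] elim assms(3,4)[OF elim] pos])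
    then show ?case
      by (simp add: powr1[OF elim] R_def gap_moment1_def del: integral_mult_right_zero)
  qed
  ultimately show "(\<lambda>n. prob_space.expectation (M n)
            (\<lambda>\<omega>. real n powr (\<alpha> - 1) * sample_fermat_dist_1d \<alpha> n (\<lambda>i. q n i \<omega>)))
           \<longlonglongrightarrow> Gamma (\<alpha> + 1)"
    by (auto intro: Lim_transform_eventually)

  \<comment> \<open>Since \<open>R (2 * \<alpha>) n = (R \<alpha> n)\<^sup>2 * w n\<close>, the two
    divergent contributions to the variance combine to n \<open>w n\<close> - (n+1) = -n (1 -
    \<open>w n\<close>) - 1, which converges to -\<alpha>^2 - 1.\<close>
  have "(\<lambda>n. (real n + 1) / real n * R (2 * \<alpha>) n * Gamma (2 * \<alpha> + 1)
       + (Gamma (\<alpha> + 1))\<^sup>2 * ((R \<alpha> n)\<^sup>2 * ((real n + 1) / real n) * (- (real n * (1 - w n)) - 1)))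
     \<longlonglongrightarrow> 1 * 1 * Gamma (2 * \<alpha> + 1) + (Gamma (\<alpha> + 1))\<^sup>2 * (1\<^sup>2 * 1 * (- (\<alpha>\<^sup>2) - 1))"
    using pos by (intro tendsto_add tendsto_mult tendsto_diff tendsto_minus tendsto_power tendsto_const quot R w) auto
  moreover have "\<forall>\<^sub>F n in sequentially.
       (real n + 1) / real n * R (2 * \<alpha>) n * Gamma (2 * \<alpha> + 1)
       + (Gamma (\<alpha> + 1))\<^sup>2 * ((R \<alpha> n)\<^sup>2 * ((real n + 1) / real n) * (- (real n * (1 - w n)) - 1))
     = real n * prob_space.variance (M n)
            (\<lambda>\<omega>. real n powr (\<alpha> - 1) * sample_fermat_dist_1d \<alpha> n (\<lambda>i. q n i \<omega>))"
    using eventually_ge_at_top[of 1]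
  proof eventually_elim
    case (elim n)
    define x f P G1 G2 A B where "x = real n" and "f = (fact n :: real)" and "P = real n powr \<alpha>"
      and "G1 = Gamma (real n + \<alpha> + 1)" and "G2 = Gamma (real n + 2 * \<alpha> + 1)"
      and "A = Gamma (\<alpha> + 1)" and "B = Gamma (2 * \<alpha> + 1)"
    note defs = this
    have p: "x > 0" "f > 0" "G1 > 0" "G2 > 0" using elim g[OF pos, of n] g[of "2 * \<alpha>" n] pos by (simp_all add: defs)
    have P2: "real n powr (2 * \<alpha>) = P\<^sup>2"
      by (simp add: defs power2_eq_square flip: powr_add)
    have "(x + 1) / x * (f * P\<^sup>2 / G2) * B + A\<^sup>2 * ((f * P / G1)\<^sup>2 * ((x + 1) / x) * (- (x * (1 - G1\<^sup>2 / (f * G2))) - 1))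
      = x * ((P / x)\<^sup>2 * ((x + 1) * f * (B + x * A\<^sup>2) / G2 - ((x + 1) * f * A / G1)\<^sup>2))"
      using p by (simp add: divide_simps) (simp add: algebra_simps power2_eq_square)
    moreover have "prob_space.variance (M n)
            (\<lambda>\<omega>. real n powr (\<alpha> - 1) * sample_fermat_dist_1d \<alpha> n (\<lambda>i. q n i \<omega>))
        = (real n powr (\<alpha> - 1))\<^sup>2 * (gap_moment2 \<alpha> n - (gap_moment1 \<alpha> n)\<^sup>2)"
      by (rule variance_scaled_sample_fermat_dist_1d[OF assms(2)[OF elim] elim assms(3,4)[OF elim] pos])
    ultimately show ?case
      unfolding powr1[OF elim] R_def gap_moment1_def gap_moment2_def w_def P2
      by (simp only: defs)
  qed
  ultimately have "(\<lambda>n. real n * prob_space.variance (M n)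
            (\<lambda>\<omega>. real n powr (\<alpha> - 1) * sample_fermat_dist_1d \<alpha> n (\<lambda>i. q n i \<omega>)))
     \<longlonglongrightarrow> 1 * 1 * Gamma (2 * \<alpha> + 1) + (Gamma (\<alpha> + 1))\<^sup>2 * (1\<^sup>2 * 1 * (- (\<alpha>\<^sup>2) - 1))"
    by (rule Lim_transform_eventually)
  then show "(\<lambda>n. real n * prob_space.variance (M n)
            (\<lambda>\<omega>. real n powr (\<alpha> - 1) * sample_fermat_dist_1d \<alpha> n (\<lambda>i. q n i \<omega>)))
           \<longlonglongrightarrow> Gamma (2 * \<alpha> + 1) - (\<alpha>\<^sup>2 + 1) * (Gamma (\<alpha> + 1))\<^sup>2"
    by (simp add: algebra_simps)
qed

end
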